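(* Let $\eta>0$, let $f$ and $\mathcal S$ satisfy the standing assumptions, and let $\{x_k\}$, $\{d_k\}$ be the sequences produced by the Armijo line search-based algorithm with inputs $x_0\in\mathcal S$, $a>0$, $\gamma,\delta\in(0,1)$, $\eta>0$, where the directions $\{d_k\}$ satisfy the direction assumption with this $\eta$, this $a$, and constants $c_1,c_2>0$. For any $\varepsilon>0$, denote by $k_\varepsilon$ the first iteration index $k$ such that $\phi_\eta(x_{k})\le\varepsilon$, and by $ni_\varepsilon$ the total number of iterations $k$ such that $\phi_\eta(x_k)>\varepsilon$. Then $$k_\varepsilon\le \frac{f(x_0)-f^*}{\delta\,\alpha_L\,\gamma\, c_2}\,\varepsilon^{-2}=\mathcal O(\varepsilon^{-2})\qquad\text{and}\qquad ni_\varepsilon\le \frac{f(x_0)-f^*}{\delta\,\alpha_L\,\gamma\, c_2}\,\varepsilon^{-2}=\mathcal O(\varepsilon^{-2}),$$ where $f^*$ is the lower bound of $f$ over $\mathcal S$ and $\alpha_L=\min\left\{a,\frac{2c_1(1-\gamma)}{L}\right\}$.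
   Context: Standing assumptions: $\mathcal S\subset\mathbb R^n$ is a (nonempty) closed convex set; $f:\mathbb R^n\to\mathbb R$ is smooth, possibly nonconvex; there is $f^*\in\mathbb R$ with $f(x)\ge f^*$ for all $x\in\mathcal S$; and there are $L>0$ and an open convex set $\mathcal D\supseteq\mathcal S$ such that $\|\nabla f(x)-\nabla f(y)\|\le L\|x-y\|$ for all $x,y\in\mathcal D$. Norms are Euclidean. Notation: $\mathcal P_{\mathcal S}[x]=\arg\min_{y\in\mathcal S}\|x-y\|$ is the Euclidean projection, and for $\eta>0$ and $x\in\mathcal S$, $\phi_\eta(x)=\|\mathcal P_{\mathcal S}[x-\eta\nabla f(x)]-x\|$. Direction assumption (for sequences $\{x_k\}\subseteq\mathcal S$, $\{d_k\}\subseteq\mathbb R^n$, a scalar $\eta>0$ and constants $a,c_1,c_2>0$): for all $k$, (i) $x_k+\alpha d_k\in\mathcal S$ for all $\alpha\in[0,a]$; (ii) $\nabla f(x_k)^Td_k\le -c_1\|d_k\|^2$; (iii) $\nabla f(x_k)^Td_k\le -c_2\,\phi_\eta(x_k)^2$. Armijo line search-based algorithm: given $x_0\in\mathcal S$, $a>0$, $\gamma,\delta\in(0,1)$, $\eta>0$, for $k=0,1,\dots$: compute $d_k$ satisfying the direction assumption (with the same constants $a,c_1,c_2$ for all $k$); set $\alpha=a$; while $f(x_k+\alpha d_k)>f(x_k)+\gamma\alpha\nabla f(x_k)^Td_k$, replace $\alpha$ by $\delta\alpha$; set $\alpha_k=\alpha$ and $x_{k+1}=x_k+\alpha_kd_k$.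 *)

theory Defs
  imports
    "HOL-Analysis.Analysis"
    "HOL-Library.While_Combinator"
    "HOL-Library.Landau_Symbols"
begin

definition grad :: "('a::euclidean_space \<Rightarrow> real) \<Rightarrow> 'a \<Rightarrow> 'a" where
  "grad f x = (THE D. GDERIV f x :> D)"

lemma grad_eqI:
  assumes "GDERIV f x :> D"
  shows "grad f x = D"
  unfolding grad_def
proof (rule the_equality)
  show "GDERIV f x :> D" by fact
next
  fix E assume "GDERIV f x :> E"
  then have "(\<lambda>h. h \<bullet> E) = (\<lambda>h. h \<bullet> D)"
    using assms unfolding gderiv_def by (rule has_derivative_unique)
  then show "E = D"
    by (metis vector_eq_ldot)
qed

lemma gderiv_grad:
  assumes "f differentiable (at x)"
  shows "GDERIV f x :> grad f x"
proof -
  obtain f' where f': "(f has_derivative f') (at x)"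
    using assms unfolding differentiable_def by blast
  then interpret linear f'
    by (rule has_derivative_linear)
  define D where "D = (\<Sum>b\<in>Basis. f' b *\<^sub>R b)"
  have "f' h = h \<bullet> D" for h
  proof -
    have "f' h = f' (\<Sum>b\<in>Basis. (h \<bullet> b) *\<^sub>R b)"
      by (simp only: euclidean_representation)
    also have "\<dots> = h \<bullet> D"
      unfolding sum scale D_def inner_sum_right by (simp add: mult.commute)
    finally show ?thesis .
  qed
  then have "GDERIV f x :> D"
    using f' unfolding gderiv_def by presburger
  then show ?thesis
    using grad_eqI by metis
qed

(* "Smooth" is read as continuously differentiable; C^infinity functions are a special case. *)
definition smooth :: "('a::euclidean_space \<Rightarrow> real) \<Rightarrow> bool" where
  "smooth f \<longleftrightarrow> (\<forall>x. f differentiable (at x)) \<and> continuous_on UNIV (grad f)"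

definition stationarity :: "'a set \<Rightarrow> ('a::euclidean_space \<Rightarrow> real) \<Rightarrow> real \<Rightarrow> 'a \<Rightarrow> real" where
  "stationarity S f \<eta> x = norm (closest_point S (x - \<eta> *\<^sub>R grad f x) - x)"

(* The first clause with \<alpha> = 0 contains x k \<in> S. *)
definition direction_assumption ::
    "'a set \<Rightarrow> ('a::euclidean_space \<Rightarrow> real) \<Rightarrow> real \<Rightarrow> real \<Rightarrow> real \<Rightarrow> real
      \<Rightarrow> (nat \<Rightarrow> 'a) \<Rightarrow> (nat \<Rightarrow> 'a) \<Rightarrow> bool" where
  "direction_assumption S f \<eta> a c1 c2 x d \<longleftrightarrow>
     (\<forall>k. (\<forall>\<alpha>\<in>{0..a}. x k + \<alpha> *\<^sub>R d k \<in> S)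
        \<and> grad f (x k) \<bullet> d k \<le> - c1 * (norm (d k))\<^sup>2
        \<and> grad f (x k) \<bullet> d k \<le> - c2 * (stationarity S f \<eta> (x k))\<^sup>2)"

(* The value is unspecified if the loop does not terminate; termination is not assumed
   anywhere, so it has to be derived from the hypotheses on f and on the direction. *)
definition armijo_step ::
    "('a::euclidean_space \<Rightarrow> real) \<Rightarrow> real \<Rightarrow> real \<Rightarrow> real \<Rightarrow> 'a \<Rightarrow> 'a \<Rightarrow> real" where
  "armijo_step f a \<gamma> \<delta> x d =
     while (\<lambda>\<alpha>. f (x + \<alpha> *\<^sub>R d) > f x + \<gamma> * \<alpha> * (grad f x \<bullet> d)) (\<lambda>\<alpha>. \<delta> * \<alpha>) a"

definition armijo_algorithm ::
    "'a set \<Rightarrow> ('a::euclidean_space \<Rightarrow> real) \<Rightarrow> real \<Rightarrow> real \<Rightarrow> real \<Rightarrow> real \<Rightarrow> real \<Rightarrow> real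
      \<Rightarrow> (nat \<Rightarrow> 'a) \<Rightarrow> (nat \<Rightarrow> 'a) \<Rightarrow> bool" where
  "armijo_algorithm S f \<eta> a \<gamma> \<delta> c1 c2 x d \<longleftrightarrow>
     x 0 \<in> S \<and> direction_assumption S f \<eta> a c1 c2 x d
     \<and> (\<forall>k. x (Suc k) = x k + armijo_step f a \<gamma> \<delta> (x k) (d k) *\<^sub>R d k)"

(* LEAST and card are only meaningful if the index exists and the set is finite. *)
definition first_index ::
    "'a set \<Rightarrow> ('a::euclidean_space \<Rightarrow> real) \<Rightarrow> real \<Rightarrow> (nat \<Rightarrow> 'a) \<Rightarrow> real \<Rightarrow> nat" where
  "first_index S f \<eta> x \<epsilon> = (LEAST k. stationarity S f \<eta> (x k) \<le> \<epsilon>)"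

definition num_iterations ::
    "'a set \<Rightarrow> ('a::euclidean_space \<Rightarrow> real) \<Rightarrow> real \<Rightarrow> (nat \<Rightarrow> 'a) \<Rightarrow> real \<Rightarrow> nat" where
  "num_iterations S f \<eta> x \<epsilon> = card {k. stationarity S f \<eta> (x k) > \<epsilon>}"

definition alpha_L :: "real \<Rightarrow> real \<Rightarrow> real \<Rightarrow> real \<Rightarrow> real" where
  "alpha_L a c1 \<gamma> L = min a (2 * c1 * (1 - \<gamma>) / L)"

end

theory Submission
  imports Defs
begin

text \<open>By the descent lemma for the \<open>L\<close>-Lipschitz gradient, every trial step at most \<open>\<alpha>\<^sub>L\<close> passes the
  Armijo test; hence backtracking terminates with a step of at least \<open>\<delta> \<alpha>\<^sub>L\<close>. Each iteration with
  \<open>\<phi>\<^sub>\<eta> > \<epsilon>\<close> therefore decreases \<open>f\<close> by at least \<open>\<delta> \<alpha>\<^sub>L \<gamma> c\<^sub>2 \<epsilon>\<^sup>2\<close>, no iteration increases \<open>f\<close>, and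
  the total decrease is at most \<open>f(x\<^sub>0) - f\<^sup>*\<close>.\<close>

text \<open>Along the segment from \<open>x\<close> to \<open>x + p\<close>, Cauchy-Schwarz and the
  Lipschitz bound let the slope of \<open>f\<close> grow by at most
  \<open>L * t * (norm p)\<^sup>2\<close>; integrating this over \<open>t\<close> in [0, 1] gives
  the factor \<open>L / 2\<close>. Convexity of \<open>D\<close> keeps the segment where the
  Lipschitz bound is available.\<close>

lemma lipschitz_grad_descent:
  fixes f :: "'a::euclidean_space \<Rightarrow> real"
  assumes diff: "\<And>z. f differentiable (at z)"
    and lip: "L-lipschitz_on D (grad f)" and D: "convex D" "x \<in> D" "x + p \<in> D"
  shows "f (x + p) \<le> f x + grad f x \<bullet> p + L / 2 * (norm p)\<^sup>2"
proof -
  \<comment> \<open>Subtracting the quadratic model from \<open>f\<close> turns the integration into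
    monotonicity: the claim is \<open>h 1 \<le> h 0\<close>, so a nonpositive derivative
    suffices.\<close>
  define h where "h t = f (x + t *\<^sub>R p) - t * (grad f x \<bullet> p) - L / 2 * t\<^sup>2 * (norm p)\<^sup>2" for t :: real
  have "h 1 \<le> h 0"
  proof (rule DERIV_nonpos_imp_nonincreasing[where a = 0 and b = 1 and f = h])
    fix t :: real assume t: "0 \<le> t" "t \<le> 1"
    let ?z = "x + t *\<^sub>R p"
    let ?h' = "p \<bullet> grad f ?z - grad f x \<bullet> p - L * t * (norm p)\<^sup>2"
    have "?z = (1 - t) *\<^sub>R x + t *\<^sub>R (x + p)"
      by (simp add: algebra_simps)
    then have z: "?z \<in> D"
      using convexD_alt[OF D(1-3) t] by simp
    have "((\<lambda>t. x + t *\<^sub>R p) has_derivative (\<lambda>s. s *\<^sub>R p)) (at t)"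
      by (auto intro!: derivative_eq_intros)
    moreover have "(f has_derivative (\<lambda>v. v \<bullet> grad f ?z)) (at ?z)"
      using gderiv_grad[OF diff, of ?z] by (simp only: gderiv_def)
    ultimately have "((\<lambda>t. f (x + t *\<^sub>R p)) has_derivative (\<lambda>s. (s *\<^sub>R p) \<bullet> grad f ?z)) (at t)"
      by (rule has_derivative_compose)
    then have "((\<lambda>t. f (x + t *\<^sub>R p)) has_real_derivative p \<bullet> grad f ?z) (at t)"
      by (simp add: has_field_derivative_def mult_commute_abs)
    then have "(h has_real_derivative ?h') (at t)"
      unfolding h_def by (auto intro!: derivative_eq_intros)
    moreover have "?h' \<le> 0"
    proof -
      have "p \<bullet> grad f ?z - grad f x \<bullet> p = (grad f ?z - grad f x) \<bullet> p"
        by (simp add: inner_diff_left inner_commute[of p])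
      also have "\<dots> \<le> norm (grad f ?z - grad f x) * norm p"
        by (rule norm_cauchy_schwarz)
      also have "\<dots> \<le> (L * norm (t *\<^sub>R p)) * norm p"
        using lipschitz_onD[OF lip z D(2)] by (intro mult_right_mono) (simp_all add: dist_norm)
      finally show ?thesis
        using t by (simp add: power2_eq_square mult_ac)
    qed
    ultimately show "\<exists>y. (h has_real_derivative y) (at t) \<and> y \<le> 0"
      by blast
  qed simp
  then show ?thesis
    by (simp add: h_def)
qed

text \<open>The Armijo test leaves a slack of \<open>(1 - \<gamma>) * \<alpha>\<close> times
  \<open>- (grad f x \<bullet> d)\<close>, which is at least
  \<open>c1 * (1 - \<gamma>) * \<alpha> * (norm d)\<^sup>2\<close>. The quadratic error of the
  descent lemma fits into it exactly when \<open>L / 2 * \<alpha> \<le> c1 * (1 - \<gamma>)\<close>,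
  whence the threshold.\<close>

lemma armijo_condition_small_step:
  fixes f :: "'a::euclidean_space \<Rightarrow> real"
  assumes diff: "\<And>z. f differentiable (at z)"
    and lip: "L-lipschitz_on D (grad f)" and D: "convex D" "x \<in> D" "x + \<alpha> *\<^sub>R d \<in> D"
    and "L > 0" "\<gamma> < 1" "0 \<le> \<alpha>" "\<alpha> \<le> 2 * c1 * (1 - \<gamma>) / L"
    and descent: "grad f x \<bullet> d \<le> - c1 * (norm d)\<^sup>2"
  shows "f (x + \<alpha> *\<^sub>R d) \<le> f x + \<gamma> * \<alpha> * (grad f x \<bullet> d)"
proof -
  have "L / 2 * \<alpha> * (norm d)\<^sup>2 \<le> c1 * (1 - \<gamma>) * (norm d)\<^sup>2"
    using assms(6,9) by (intro mult_right_mono) (simp_all add: field_simps)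
  also have "\<dots> \<le> (1 - \<gamma>) * - (grad f x \<bullet> d)"
    using mult_left_mono[OF descent, of "1 - \<gamma>"] assms(7) by (simp add: algebra_simps)
  finally have "\<alpha> * (L / 2 * \<alpha> * (norm d)\<^sup>2) \<le> \<alpha> * ((1 - \<gamma>) * - (grad f x \<bullet> d))"
    using assms(8) by (intro mult_left_mono)
  moreover have "f (x + \<alpha> *\<^sub>R d) \<le> f x + \<alpha> * (grad f x \<bullet> d) + \<alpha> * (L / 2 * \<alpha> * (norm d)\<^sup>2)"
    using lipschitz_grad_descent[OF diff lip D] by (simp add: power2_eq_square mult_ac)
  ultimately show ?thesis
    by (simp add: algebra_simps)
qed

text \<open>Either \<open>a\<close> itself is accepted, or the last rejected step exceeds
  \<open>m\<close> and is multiplied by \<delta> once more; hence the lower bound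
  \<open>\<delta> * m\<close>. Termination is part of the proof, since \<open>while\<close> says
  nothing about a diverging loop.\<close>

lemma while_backtracking:
  fixes a \<delta> m :: real
  assumes "0 < \<delta>" "\<delta> < 1" "0 < m" "m \<le> a"
    and accept: "\<And>\<alpha>. 0 \<le> \<alpha> \<Longrightarrow> \<alpha> \<le> m \<Longrightarrow> \<not> b \<alpha>"
  shows "\<not> b (while b (\<lambda>\<alpha>. \<delta> * \<alpha>) a)" and "\<delta> * m \<le> while b (\<lambda>\<alpha>. \<delta> * \<alpha>) a"
proof -
  let ?Q = "\<lambda>\<alpha>. \<not> b \<alpha> \<and> \<delta> * m \<le> \<alpha>"
  \<comment> \<open>A rejected step exceeds \<open>m\<close>, so shrinking it lowers it by at least \<open>(1 - \<delta>) m\<close>.\<close>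
  let ?\<mu> = "\<lambda>\<alpha>. nat \<lceil>\<alpha> / ((1 - \<delta>) * m)\<rceil>"
  have rejected: "\<alpha> > m" if "b \<alpha>" "\<delta> * m \<le> \<alpha>" for \<alpha>
  proof (rule ccontr)
    have "0 < \<delta> * m"
      using assms by simp
    moreover assume "\<not> \<alpha> > m"
    ultimately show False
      using accept[of \<alpha>] that by linarith
  qed
  have "?Q (while b (\<lambda>\<alpha>. \<delta> * \<alpha>) a)"
  proof (rule while_rule[where P = "\<lambda>\<alpha>. \<delta> * m \<le> \<alpha>" and r = "Wellfounded.measure ?\<mu>"])
    have "\<delta> * m \<le> 1 * m"
      using assms by (intro mult_right_mono) auto
    then show "\<delta> * m \<le> a"
      using assms(4) by linarith
  next
    fix \<alpha> assume "\<delta> * m \<le> \<alpha>" "b \<alpha>"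
    then have "m < \<alpha>"
      by (rule rejected[rotated])
    then show "\<delta> * m \<le> \<delta> * \<alpha>"
      using assms by simp
    have pos: "0 < (1 - \<delta>) * m"
      using assms by simp
    have "\<delta> * \<alpha> + (1 - \<delta>) * m \<le> \<alpha>"
      using mult_left_mono[of m \<alpha> "1 - \<delta>"] assms \<open>m < \<alpha>\<close> by (simp add: algebra_simps)
    then have "(\<delta> * \<alpha> + (1 - \<delta>) * m) / ((1 - \<delta>) * m) \<le> \<alpha> / ((1 - \<delta>) * m)"
      using pos by (intro divide_right_mono) auto
    then have "\<delta> * \<alpha> / ((1 - \<delta>) * m) + 1 \<le> \<alpha> / ((1 - \<delta>) * m)"
      using pos assms by (simp add: add_divide_distrib)
    then have "\<lceil>\<delta> * \<alpha> / ((1 - \<delta>) * m)\<rceil> + 1 \<le> \<lceil>\<alpha> / ((1 - \<delta>) * m)\<rceil>"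
      by linarith
    \<comment> \<open>Positivity rules out truncation by \<open>nat\<close>, so the drop of the
      ceiling by one is a strict decrease of the measure.\<close>
    moreover have "0 < \<lceil>\<alpha> / ((1 - \<delta>) * m)\<rceil>"
      using pos assms \<open>m < \<alpha>\<close> by simp
    ultimately show "(\<delta> * \<alpha>, \<alpha>) \<in> Wellfounded.measure ?\<mu>"
      by simp
  qed auto
  then show "\<not> b (while b (\<lambda>\<alpha>. \<delta> * \<alpha>) a)" "\<delta> * m \<le> while b (\<lambda>\<alpha>. \<delta> * \<alpha>) a"
    by auto
qed

lemma sufficient_decrease_count:
  fixes v \<phi> :: "nat \<Rightarrow> real"
  assumes bound: "\<And>k. l \<le> v k" and "c > 0" "\<epsilon> > 0"
    and decrease: "\<And>k. v (Suc k) \<le> v k - c * (\<phi> k)\<^sup>2"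
  shows "finite {k. \<phi> k > \<epsilon>}" and "real (card {k. \<phi> k > \<epsilon>}) \<le> (v 0 - l) / c * \<epsilon> powr (-2)"
proof -
  \<comment> \<open>The bound is first shown for every finite set of such indices, because
    \<open>card\<close> is 0 on infinite sets. Its uniformity in \<open>K\<close> then yields
    finiteness as well.\<close>
  have card_le: "real (card K) \<le> (v 0 - l) / c * \<epsilon> powr (-2)"
    if K: "finite K" "K \<subseteq> {k. \<phi> k > \<epsilon>}" for K
  proof -
    obtain n where n: "K \<subseteq> {..<n}"
      using K(1) finite_nat_bounded by auto
    have "real (card K) * (c * \<epsilon>\<^sup>2) = (\<Sum>k\<in>K. c * \<epsilon>\<^sup>2)"
      by simp
    also have "\<dots> \<le> (\<Sum>k\<in>K. c * (\<phi> k)\<^sup>2)"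
      using K(2) assms(2,3) by (intro sum_mono mult_left_mono power_mono) auto
    \<comment> \<open>The added terms are nonnegative; filling \<open>K\<close> up to an initial
      segment makes the sum of decreases telescope.\<close>
    also have "\<dots> \<le> (\<Sum>k<n. c * (\<phi> k)\<^sup>2)"
      using n assms(2) by (intro sum_mono2) auto
    also have "\<dots> \<le> (\<Sum>k<n. v k - v (Suc k))"
      using decrease by (intro sum_mono) (simp add: algebra_simps)
    also have "\<dots> = v 0 - v n"
      by (rule sum_lessThan_telescope')
    also have "\<dots> \<le> v 0 - l"
      using bound by simp
    finally have "real (card K) \<le> (v 0 - l) / (c * \<epsilon>\<^sup>2)"
      using assms(2,3) by (simp add: pos_le_divide_eq)
    then show ?thesis
      using assms(3) by (simp add: powr_minus powr_numeral divide_inverse mult_ac)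
  qed
  show "finite {k. \<phi> k > \<epsilon>}"
  proof (rule ccontr)
    assume "infinite {k. \<phi> k > \<epsilon>}"
    moreover obtain N where "(v 0 - l) / c * \<epsilon> powr (-2) < real N"
      using reals_Archimedean2 by blast
    ultimately show False
      using card_le infinite_arbitrarily_large by (metis less_le_not_le)
  qed
  then show "real (card {k. \<phi> k > \<epsilon>}) \<le> (v 0 - l) / c * \<epsilon> powr (-2)"
    by (rule card_le) simp
qed

text \<open>All indices below the first success are failures, so a bound on the number of failures
  also bounds the first index.\<close>

lemma Least_le_card:
  fixes P :: "nat \<Rightarrow> bool"
  assumes "finite {k. \<not> P k}"
  shows "(LEAST k. P k) \<le> card {k. \<not> P k}"
proof -
  have "{..<(LEAST k. P k)} \<subseteq> {k. \<not> P k}"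
    using not_less_Least by auto
  then show ?thesis
    using card_mono[OF assms] by (metis card_lessThan)
qed

lemma bigo_at_right_0I:
  fixes F g :: "real \<Rightarrow> real"
  assumes "\<And>\<epsilon>. \<epsilon> > 0 \<Longrightarrow> 0 \<le> F \<epsilon>" "\<And>\<epsilon>. \<epsilon> > 0 \<Longrightarrow> F \<epsilon> \<le> C * g \<epsilon>" "\<And>\<epsilon>. \<epsilon> > 0 \<Longrightarrow> 0 \<le> g \<epsilon>"
  shows "F \<in> O[at_right 0](g)"
proof (rule bigoI[where c = C])
  show "\<forall>\<^sub>F \<epsilon> in at_right 0. norm (F \<epsilon>) \<le> C * norm (g \<epsilon>)"
    using eventually_at_right_less by eventually_elim (simp add: assms)
qed

lemma armijo_algorithm_decrease:
  fixes f :: "'a::euclidean_space \<Rightarrow> real"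
  assumes "\<And>z. f differentiable (at z)"
    and "L > 0" "convex D" "S \<subseteq> D" "L-lipschitz_on D (grad f)"
    and "a > 0" "0 < \<gamma>" "\<gamma> < 1" "0 < \<delta>" "\<delta> < 1" "c1 > 0"
    and alg: "armijo_algorithm S f \<eta> a \<gamma> \<delta> c1 c2 x d" and "c2 > 0"
  shows "f (x (Suc k)) \<le> f (x k) - \<delta> * alpha_L a c1 \<gamma> L * \<gamma> * c2 * (stationarity S f \<eta> (x k))\<^sup>2"
proof -
  let ?m = "alpha_L a c1 \<gamma> L" and ?\<alpha> = "armijo_step f a \<gamma> \<delta> (x k) (d k)"
  let ?g = "grad f (x k) \<bullet> d k" and ?\<phi> = "stationarity S f \<eta> (x k)"
  have dir: "\<And>\<alpha>. 0 \<le> \<alpha> \<Longrightarrow> \<alpha> \<le> a \<Longrightarrow> x k + \<alpha> *\<^sub>R d k \<in> S"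
      "?g \<le> - c1 * (norm (d k))\<^sup>2" "?g \<le> - c2 * ?\<phi>\<^sup>2"
    and step: "x (Suc k) = x k + ?\<alpha> *\<^sub>R d k"
    using alg unfolding armijo_algorithm_def direction_assumption_def by auto
  have m: "0 < ?m" "?m \<le> a" "?m \<le> 2 * c1 * (1 - \<gamma>) / L"
    using assms by (auto simp: alpha_L_def)
  have "x k \<in> D"
    using dir(1)[of 0] assms by auto
  \<comment> \<open>The two arguments of the minimum in \<open>alpha_L\<close> do separate work:
    \<open>a\<close> keeps the trial point in \<open>S\<close>, hence in \<open>D\<close>, and the
    other one ensures the Armijo inequality.\<close>
  have accept: "\<not> f (x k + \<alpha> *\<^sub>R d k) > f (x k) + \<gamma> * \<alpha> * ?g" if "0 \<le> \<alpha>" "\<alpha> \<le> ?m" for \<alpha>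
  proof -
    have "x k + \<alpha> *\<^sub>R d k \<in> D"
      using dir(1)[of \<alpha>] assms(4) m(2) that by auto
    then have "f (x k + \<alpha> *\<^sub>R d k) \<le> f (x k) + \<gamma> * \<alpha> * ?g"
      using assms m(3) that \<open>x k \<in> D\<close> dir(2)
      by (intro armijo_condition_small_step[where D = D and L = L and ?c1.0 = c1]) auto
    then show ?thesis by simp
  qed
  have backtrack: "f (x k + ?\<alpha> *\<^sub>R d k) \<le> f (x k) + \<gamma> * ?\<alpha> * ?g" "\<delta> * ?m \<le> ?\<alpha>"
    using while_backtracking[OF \<open>0 < \<delta>\<close> \<open>\<delta> < 1\<close> m(1,2) accept]
    unfolding armijo_step_def by (simp_all only: not_less)
  \<comment> \<open>The lower bound on the step becomes a decrease independent of the accepted step,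
    because \<open>c2 * ?\<phi>\<^sup>2\<close> is nonnegative.\<close>
  have "?\<alpha> * c2 * ?\<phi>\<^sup>2 \<ge> \<delta> * ?m * c2 * ?\<phi>\<^sup>2"
    using backtrack(2) assms by (intro mult_right_mono) auto
  moreover have "?\<alpha> * ?g \<le> ?\<alpha> * (- c2 * ?\<phi>\<^sup>2)"
    using backtrack(2) m(1) assms dir(3) by (intro mult_left_mono) (auto intro: order_trans[rotated])
  ultimately have "?\<alpha> * ?g \<le> - (\<delta> * ?m * c2 * ?\<phi>\<^sup>2)"
    by simp
  then have "\<gamma> * (?\<alpha> * ?g) \<le> \<gamma> * - (\<delta> * ?m * c2 * ?\<phi>\<^sup>2)"
    using assms by (intro mult_left_mono) auto
  then show ?thesis
    using backtrack(1) step by (simp add: mult_ac)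
qed

theorem proposition3p2:
  fixes S D :: "(real ^ 'n) set"
    and f :: "real ^ 'n \<Rightarrow> real"
    and fstar L \<eta> a \<gamma> \<delta> c1 c2 :: real
    and x d :: "nat \<Rightarrow> real ^ 'n"
  assumes "S \<noteq> {}" and "closed S" and "convex S"
    and "smooth f"
    and "\<And>y. y \<in> S \<Longrightarrow> f y \<ge> fstar"
    and "L > 0" and "open D" and "convex D" and "S \<subseteq> D" and "L-lipschitz_on D (grad f)"
    and "\<eta> > 0" and "a > 0" and "0 < \<gamma>" and "\<gamma> < 1" and "0 < \<delta>" and "\<delta> < 1"
    and "c1 > 0" and "c2 > 0"
    and "armijo_algorithm S f \<eta> a \<gamma> \<delta> c1 c2 x d"
  shows "(\<forall>\<epsilon>>0.
            (\<exists>k. stationarity S f \<eta> (x k) \<le> \<epsilon>)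
          \<and> real (first_index S f \<eta> x \<epsilon>)
              \<le> (f (x 0) - fstar) / (\<delta> * alpha_L a c1 \<gamma> L * \<gamma> * c2) * \<epsilon> powr (-2)
          \<and> finite {k. stationarity S f \<eta> (x k) > \<epsilon>}
          \<and> real (num_iterations S f \<eta> x \<epsilon>)
              \<le> (f (x 0) - fstar) / (\<delta> * alpha_L a c1 \<gamma> L * \<gamma> * c2) * \<epsilon> powr (-2))
       \<and> (\<lambda>\<epsilon>. real (first_index S f \<eta> x \<epsilon>)) \<in> O[at_right 0](\<lambda>\<epsilon>. \<epsilon> powr (-2))
       \<and> (\<lambda>\<epsilon>. real (num_iterations S f \<eta> x \<epsilon>)) \<in> O[at_right 0](\<lambda>\<epsilon>. \<epsilon> powr (-2))"
proof -
  let ?\<phi> = "\<lambda>k. stationarity S f \<eta> (x k)" and ?c = "\<delta> * alpha_L a c1 \<gamma> L * \<gamma> * c2"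
  let ?C = "(f (x 0) - fstar) / ?c"
  have "f differentiable (at z)" for z
    using assms(4) by (simp add: smooth_def)
  then have decrease: "f (x (Suc k)) \<le> f (x k) - ?c * (?\<phi> k)\<^sup>2" for k
    using assms by (intro armijo_algorithm_decrease[where D = D]) auto
  have "x k \<in> S" for k
    using assms(12,19) unfolding armijo_algorithm_def direction_assumption_def
    by (metis add.right_neutral atLeastAtMost_iff less_eq_real_def scaleR_zero_left)
  then have bound: "fstar \<le> f (x k)" for k
    using assms(5) by blast
  have "?c > 0"
    using assms by (simp add: alpha_L_def)
  \<comment> \<open>The open premise is the positivity of \<epsilon>; the decrease constant
    \<open>?c\<close> does not depend on it, so one instance serves all \<epsilon>.\<close>
  note count = sufficient_decrease_count[where v = "\<lambda>k. f (x k)" and \<phi> = ?\<phi>, OF bound this _ decrease]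
  have num: "real (num_iterations S f \<eta> x \<epsilon>) \<le> ?C * \<epsilon> powr (-2)" if "\<epsilon> > 0" for \<epsilon>
    using count(2)[OF that] by (simp add: num_iterations_def)
  have first: "real (first_index S f \<eta> x \<epsilon>) \<le> ?C * \<epsilon> powr (-2)" if "\<epsilon> > 0" for \<epsilon>
  proof -
    have "first_index S f \<eta> x \<epsilon> \<le> num_iterations S f \<eta> x \<epsilon>"
      using Least_le_card[of "\<lambda>k. ?\<phi> k \<le> \<epsilon>"] count(1)[OF that]
      by (simp add: first_index_def num_iterations_def not_le)
    then show ?thesis
      using num[OF that] by linarith
  qed
  \<comment> \<open>Finitely many indices violate the tolerance, so some index meets it and the
    \<open>LEAST\<close> in \<open>first_index\<close> is a genuine minimum.\<close>
  have ex: "\<exists>k. ?\<phi> k \<le> \<epsilon>" if "\<epsilon> > 0" for \<epsilon>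
    using ex_new_if_finite[OF infinite_UNIV_nat count(1)[OF that]] by (auto simp: not_less)
  show ?thesis
    using num first ex count(1)
    by (intro conjI allI impI bigo_at_right_0I[where C = ?C]) auto
qed

end
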